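(* If a $k$-graph $\Lambda$ has an initial vertex, then its topological realization $|\Lambda|$ is contractible.
   Context: A $k$-graph is a countable small category $\Lambda$ with a functor $d\colon\Lambda\to\mathbb{N}^k$ ($0\in\mathbb{N}$; $\mathbb{N}^k$ a one-object category under addition) with the factorization property: if $d(\lambda)=m+n$ there are unique morphisms $\mu,\nu$ with $d(\mu)=m$, $d(\nu)=n$, $\lambda=\mu\nu$. Here $\mu\nu$ is defined iff $s(\mu)=r(\nu)$ ($s$ = source, $r$ = range). $\lambda\in\Lambda$ means $\lambda$ is a morphism; objects are called vertices. For $0\le m\le n\le d(\lambda)$ (coordinatewise), $\lambda(m,n)$ is the unique morphism of degree $n-m$ with $\lambda=\lambda'\lambda(m,n)\lambda''$, $d(\lambda')=m$. A vertex $\alpha$ is initial if for every vertex $v$ there is exactly one morphism of $\Lambda$ with source $\alpha$ and range $v$. Topological realization: for $n\in\mathbb{N}^k$ let $[0,n]=\{x\in\mathbb{R}^k:0\le x_i\le n_i\}$. Then $|\Lambda|$ is the quotient space of $\bigsqcup_{\lambda\in\Lambda}\{\lambda\}\times[0,d(\lambda)]$ by the equivalence relation: $(\mu,x)\sim(\nu,y)$ iff $\mu(\lfloor x\rfloor,\lceil x\rceil)=\nu(\lfloor y\rfloor,\lceil y\rceil)$ and $x-\lfloor x\rfloor=y-\lfloor y\rfloor$, where floor and ceiling are applied coordinatewise. *)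

theory Defs
  imports "HOL-Analysis.Analysis"
begin

section \<open>Small categories\<close>

text \<open>
  \<open>cmp C \<mu> \<nu>\<close> is the composite \<open>\<mu>\<nu>\<close>; it is meaningful exactly when \<open>src C \<mu> = rng C \<nu>\<close>,
  and nothing is assumed about its value otherwise.
\<close>

record ('v, 'm) precategory =
  Obj :: "'v set"
  Mor :: "'m set"
  src :: "'m \<Rightarrow> 'v"
  rng :: "'m \<Rightarrow> 'v"
  idn :: "'v \<Rightarrow> 'm"
  cmp :: "'m \<Rightarrow> 'm \<Rightarrow> 'm"

locale small_category =
  fixes C :: "('v, 'm, 'z) precategory_scheme"
  assumes src_Obj: "\<mu> \<in> Mor C \<Longrightarrow> src C \<mu> \<in> Obj C"
    and rng_Obj: "\<mu> \<in> Mor C \<Longrightarrow> rng C \<mu> \<in> Obj C"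
    and idn_Mor: "v \<in> Obj C \<Longrightarrow> idn C v \<in> Mor C"
    and src_idn: "v \<in> Obj C \<Longrightarrow> src C (idn C v) = v"
    and rng_idn: "v \<in> Obj C \<Longrightarrow> rng C (idn C v) = v"
    and cmp_Mor: "\<lbrakk>\<mu> \<in> Mor C; \<nu> \<in> Mor C; src C \<mu> = rng C \<nu>\<rbrakk> \<Longrightarrow> cmp C \<mu> \<nu> \<in> Mor C"
    and src_cmp: "\<lbrakk>\<mu> \<in> Mor C; \<nu> \<in> Mor C; src C \<mu> = rng C \<nu>\<rbrakk> \<Longrightarrow> src C (cmp C \<mu> \<nu>) = src C \<nu>"
    and rng_cmp: "\<lbrakk>\<mu> \<in> Mor C; \<nu> \<in> Mor C; src C \<mu> = rng C \<nu>\<rbrakk> \<Longrightarrow> rng C (cmp C \<mu> \<nu>) = rng C \<mu>"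
    and cmp_idn_left: "\<mu> \<in> Mor C \<Longrightarrow> cmp C (idn C (rng C \<mu>)) \<mu> = \<mu>"
    and cmp_idn_right: "\<mu> \<in> Mor C \<Longrightarrow> cmp C \<mu> (idn C (src C \<mu>)) = \<mu>"
    and cmp_assoc: "\<lbrakk>\<kappa> \<in> Mor C; \<mu> \<in> Mor C; \<nu> \<in> Mor C; src C \<kappa> = rng C \<mu>; src C \<mu> = rng C \<nu>\<rbrakk>
          \<Longrightarrow> cmp C (cmp C \<kappa> \<mu>) \<nu> = cmp C \<kappa> (cmp C \<mu> \<nu>)"

definition initial_vertex :: "('v, 'm, 'z) precategory_scheme \<Rightarrow> 'v \<Rightarrow> bool" where
  "initial_vertex C \<alpha> \<longleftrightarrow>
     \<alpha> \<in> Obj C \<and> (\<forall>v \<in> Obj C. \<exists>!\<kappa>. \<kappa> \<in> Mor C \<and> src C \<kappa> = \<alpha> \<and> rng C \<kappa> = v)"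


section \<open>Higher-rank graphs\<close>

text \<open>
  The monoid \<open>\<nat>\<^sup>k\<close> is the set of \<open>nat\<close>-indexed sequences that vanish from index \<open>k\<close> on, matching
  the library's \<open>Euclidean_space k\<close> for \<open>\<real>\<^sup>k\<close>; in this way \<open>k = 0\<close> is included.
\<close>

definition Nk :: "nat \<Rightarrow> (nat \<Rightarrow> nat) set" where
  "Nk k = {n. \<forall>i\<ge>k. n i = 0}"

record ('v, 'm) graded_category = "('v, 'm) precategory" +
  deg :: "'m \<Rightarrow> nat \<Rightarrow> nat"

text \<open>
  Countability of the set of morphisms gives countability of the set of objects,
  since \<open>idn\<close> is injective on objects.
\<close>

locale k_graph = small_category \<Lambda>
  for k :: nat and \<Lambda> :: "('v, 'm, 'z) graded_category_scheme" +
  assumes countable_Mor: "countable (Mor \<Lambda>)"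
    and deg_Nk: "\<kappa> \<in> Mor \<Lambda> \<Longrightarrow> deg \<Lambda> \<kappa> \<in> Nk k"
    and deg_idn: "v \<in> Obj \<Lambda> \<Longrightarrow> deg \<Lambda> (idn \<Lambda> v) = (\<lambda>i. 0)"
    and deg_cmp: "\<lbrakk>\<mu> \<in> Mor \<Lambda>; \<nu> \<in> Mor \<Lambda>; src \<Lambda> \<mu> = rng \<Lambda> \<nu>\<rbrakk>
          \<Longrightarrow> deg \<Lambda> (cmp \<Lambda> \<mu> \<nu>) = (\<lambda>i. deg \<Lambda> \<mu> i + deg \<Lambda> \<nu> i)"
    and factorization: "\<lbrakk>\<kappa> \<in> Mor \<Lambda>; m \<in> Nk k; n \<in> Nk k; deg \<Lambda> \<kappa> = (\<lambda>i. m i + n i)\<rbrakk>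
          \<Longrightarrow> \<exists>!p. fst p \<in> Mor \<Lambda> \<and> snd p \<in> Mor \<Lambda> \<and> src \<Lambda> (fst p) = rng \<Lambda> (snd p) \<and>
                  deg \<Lambda> (fst p) = m \<and> deg \<Lambda> (snd p) = n \<and> \<kappa> = cmp \<Lambda> (fst p) (snd p)"

text \<open>
  \<open>segment \<Lambda> \<kappa> m n\<close> is the morphism \<open>\<kappa>(m,n)\<close>, for \<open>m \<le> n \<le> d(\<kappa>)\<close> pointwise.
\<close>

definition is_segment ::
  "('v, 'm, 'z) graded_category_scheme \<Rightarrow> 'm \<Rightarrow> (nat \<Rightarrow> nat) \<Rightarrow> (nat \<Rightarrow> nat) \<Rightarrow> 'm \<Rightarrow> bool" where
  "is_segment \<Lambda> \<kappa> m n \<sigma> \<longleftrightarrow>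
     \<sigma> \<in> Mor \<Lambda> \<and> deg \<Lambda> \<sigma> = (\<lambda>i. n i - m i) \<and>
     (\<exists>\<theta> \<in> Mor \<Lambda>. \<exists>\<rho> \<in> Mor \<Lambda>.
        src \<Lambda> \<theta> = rng \<Lambda> \<sigma> \<and> src \<Lambda> \<sigma> = rng \<Lambda> \<rho> \<and> deg \<Lambda> \<theta> = m \<and>
        \<kappa> = cmp \<Lambda> \<theta> (cmp \<Lambda> \<sigma> \<rho>))"

definition segment ::
  "('v, 'm, 'z) graded_category_scheme \<Rightarrow> 'm \<Rightarrow> (nat \<Rightarrow> nat) \<Rightarrow> (nat \<Rightarrow> nat) \<Rightarrow> 'm" where
  "segment \<Lambda> \<kappa> m n = (THE \<sigma>. is_segment \<Lambda> \<kappa> m n \<sigma>)"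

lemma (in k_graph) ex1_segment:
  assumes l: "l \<in> Mor \<Lambda>" and mn: "\<And>i. m i \<le> n i" and nd: "\<And>i. n i \<le> deg \<Lambda> l i"
  shows "\<exists>!\<sigma>. is_segment \<Lambda> l m n \<sigma>"
proof -
  let ?p = "\<lambda>i. n i - m i" and ?q = "\<lambda>i. deg \<Lambda> l i - n i" and ?t = "\<lambda>i. deg \<Lambda> l i - m i"
  have d: "deg \<Lambda> l i = 0" if "k \<le> i" for i
    using deg_Nk[OF l] that by (auto simp: Nk_def)
  have N: "m \<in> Nk k" "?p \<in> Nk k" "?q \<in> Nk k" "?t \<in> Nk k"
    using d mn nd by (simp_all add: Nk_def) (metis le_zero_eq)+
  have e1: "deg \<Lambda> l = (\<lambda>i. m i + ?t i)"
  proof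
    fix i show "deg \<Lambda> l i = m i + ?t i"
      using mn[of i] nd[of i] by simp
  qed
  have e2: "?t = (\<lambda>i. ?p i + ?q i)"
  proof
    fix i show "?t i = ?p i + ?q i"
      using mn[of i] nd[of i] by simp
  qed
  obtain a b where ab: "a \<in> Mor \<Lambda>" "b \<in> Mor \<Lambda>" "src \<Lambda> a = rng \<Lambda> b"
      "deg \<Lambda> a = m" "deg \<Lambda> b = ?t" "l = cmp \<Lambda> a b"
    using ex1_implies_ex[OF factorization[OF l N(1,4) e1]] by blast
  have b_deg: "deg \<Lambda> b = (\<lambda>i. ?p i + ?q i)"
    using ab(5) e2 by simp
  obtain s c where sc: "s \<in> Mor \<Lambda>" "c \<in> Mor \<Lambda>" "src \<Lambda> s = rng \<Lambda> c"
      "deg \<Lambda> s = ?p" "deg \<Lambda> c = ?q" "b = cmp \<Lambda> s c"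
    using ex1_implies_ex[OF factorization[OF ab(2) N(2,3) b_deg]] by blast
  have s_seg: "is_segment \<Lambda> l m n s"
    unfolding is_segment_def
  proof (intro conjI bexI)
    show "src \<Lambda> a = rng \<Lambda> s"
      using ab(3) sc rng_cmp by simp
    show "l = cmp \<Lambda> a (cmp \<Lambda> s c)"
      using ab(6) sc(6) by simp
  qed (use ab sc in auto)
  moreover have "x = s" if "is_segment \<Lambda> l m n x" for x
  proof -
    obtain a' c' where x: "x \<in> Mor \<Lambda>" "deg \<Lambda> x = ?p" "a' \<in> Mor \<Lambda>" "c' \<in> Mor \<Lambda>"
        "src \<Lambda> a' = rng \<Lambda> x" "src \<Lambda> x = rng \<Lambda> c'" "deg \<Lambda> a' = m" "l = cmp \<Lambda> a' (cmp \<Lambda> x c')"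
      using \<open>is_segment \<Lambda> l m n x\<close> unfolding is_segment_def by blast
    let ?b = "cmp \<Lambda> x c'"
    have b': "?b \<in> Mor \<Lambda>" "src \<Lambda> a' = rng \<Lambda> ?b"
      using x cmp_Mor rng_cmp by auto
    have dl: "deg \<Lambda> l i = m i + deg \<Lambda> ?b i" for i
      using deg_cmp[OF x(3) b'] x(7,8) by simp
    have db: "deg \<Lambda> ?b = ?t"
      by (rule ext) (simp add: dl)
    have "(a', ?b) = (a, b)"
      by (rule Uniq_D[OF conjunct2[OF iffD1[OF ex1_iff_ex_Uniq factorization[OF l N(1,4) e1]]]])
        (use x b' ab db in simp_all)
    then have beq: "b = cmp \<Lambda> x c'" by simp
    have dbi: "deg \<Lambda> ?b i = (n i - m i) + deg \<Lambda> c' i" for i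
      using deg_cmp[OF x(1,4,6)] x(2) by simp
    have dc: "deg \<Lambda> c' = ?q"
    proof
      fix i show "deg \<Lambda> c' i = ?q i"
        using dbi[of i] db mn[of i] nd[of i] by (simp add: fun_eq_iff)
    qed
    have "(x, c') = (s, c)"
      by (rule Uniq_D[OF conjunct2[OF iffD1[OF ex1_iff_ex_Uniq factorization[OF ab(2) N(2,3) b_deg]]]])
        (use x sc dc beq in simp_all)
    then show ?thesis by simp
  qed
  ultimately show ?thesis by blast
qed


section \<open>Quotient spaces\<close>

text \<open>
  The points are the classes \<open>R `` {x}\<close>; a set of classes is open iff its preimage
  under the class map is open.
\<close>

definition quotient_space :: "'a topology \<Rightarrow> ('a \<times> 'a) set \<Rightarrow> 'a set topology" where
  "quotient_space X R =
     topology (\<lambda>U. U \<subseteq> topspace X // R \<and> openin X {x \<in> topspace X. R `` {x} \<in> U})"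

lemma openin_quotient_space:
  "openin (quotient_space X R) U \<longleftrightarrow>
     U \<subseteq> topspace X // R \<and> openin X {x \<in> topspace X. R `` {x} \<in> U}"
proof -
  have "istopology (\<lambda>U. U \<subseteq> topspace X // R \<and> openin X {x \<in> topspace X. R `` {x} \<in> U})"
    unfolding istopology_def
  proof (intro conjI allI impI)
    fix S T
    assume S: "S \<subseteq> topspace X // R \<and> openin X {x \<in> topspace X. R `` {x} \<in> S}"
      and T: "T \<subseteq> topspace X // R \<and> openin X {x \<in> topspace X. R `` {x} \<in> T}"
    have "{x \<in> topspace X. R `` {x} \<in> S \<inter> T} =
        {x \<in> topspace X. R `` {x} \<in> S} \<inter> {x \<in> topspace X. R `` {x} \<in> T}"
      by auto
    then show "openin X {x \<in> topspace X. R `` {x} \<in> S \<inter> T}"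
      using S T by (simp add: openin_Int)
    show "S \<inter> T \<subseteq> topspace X // R"
      using S by blast
  next
    fix K
    assume K: "\<forall>S\<in>K. S \<subseteq> topspace X // R \<and> openin X {x \<in> topspace X. R `` {x} \<in> S}"
    have "{x \<in> topspace X. R `` {x} \<in> \<Union>K} = (\<Union>S\<in>K. {x \<in> topspace X. R `` {x} \<in> S})"
      by auto
    then show "openin X {x \<in> topspace X. R `` {x} \<in> \<Union>K}"
      using K by auto
    show "\<Union>K \<subseteq> topspace X // R"
      using K by blast
  qed
  then show ?thesis
    by (simp add: quotient_space_def)
qed

lemma topspace_quotient_space: "topspace (quotient_space X R) = topspace X // R"
proof
  show "topspace (quotient_space X R) \<subseteq> topspace X // R"
    using openin_quotient_space openin_topspace by blast
  have "{x \<in> topspace X. R `` {x} \<in> topspace X // R} = topspace X"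
    by (auto intro: quotientI)
  then have "openin (quotient_space X R) (topspace X // R)"
    by (simp add: openin_quotient_space)
  then show "topspace X // R \<subseteq> topspace (quotient_space X R)"
    by (rule openin_subset)
qed

lemma quotient_map_quotient_space: "quotient_map X (quotient_space X R) (\<lambda>x. R `` {x})"
  unfolding quotient_map_def
  by (auto simp: topspace_quotient_space openin_quotient_space quotient_def)


section \<open>The topological realization\<close>

definition cube :: "nat \<Rightarrow> (nat \<Rightarrow> nat) \<Rightarrow> (nat \<Rightarrow> real) topology" where
  "cube k n = subtopology (Euclidean_space k) {x. \<forall>i<k. 0 \<le> x i \<and> x i \<le> real (n i)}"

definition boxes ::
  "nat \<Rightarrow> ('v, 'm, 'z) graded_category_scheme \<Rightarrow> ('m \<times> (nat \<Rightarrow> real)) topology" where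
  "boxes k \<Lambda> = sum_topology (\<lambda>\<mu>. cube k (deg \<Lambda> \<mu>)) (Mor \<Lambda>)"

text \<open>The casts by \<open>nat\<close> are harmless: points of a box have nonnegative coordinates.\<close>

definition floor_vec :: "(nat \<Rightarrow> real) \<Rightarrow> nat \<Rightarrow> nat" where
  "floor_vec x = (\<lambda>i. nat \<lfloor>x i\<rfloor>)"

definition ceiling_vec :: "(nat \<Rightarrow> real) \<Rightarrow> nat \<Rightarrow> nat" where
  "ceiling_vec x = (\<lambda>i. nat \<lceil>x i\<rceil>)"

definition realization_rel ::
  "nat \<Rightarrow> ('v, 'm, 'z) graded_category_scheme \<Rightarrow>
     (('m \<times> (nat \<Rightarrow> real)) \<times> ('m \<times> (nat \<Rightarrow> real))) set" where
  "realization_rel k \<Lambda> =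
     {((\<mu>, x), (\<nu>, y)) | \<mu> x \<nu> y.
        (\<mu>, x) \<in> topspace (boxes k \<Lambda>) \<and> (\<nu>, y) \<in> topspace (boxes k \<Lambda>) \<and>
        segment \<Lambda> \<mu> (floor_vec x) (ceiling_vec x) = segment \<Lambda> \<nu> (floor_vec y) (ceiling_vec y) \<and>
        (\<forall>i. x i - real (floor_vec x i) = y i - real (floor_vec y i))}"

lemma equiv_realization_rel: "equiv (topspace (boxes k \<Lambda>)) (realization_rel k \<Lambda>)"
  by (rule equivI) (auto simp: realization_rel_def refl_on_def sym_def trans_def)

definition realization ::
  "nat \<Rightarrow> ('v, 'm, 'z) graded_category_scheme \<Rightarrow> ('m \<times> (nat \<Rightarrow> real)) set topology" where
  "realization k \<Lambda> = quotient_space (boxes k \<Lambda>) (realization_rel k \<Lambda>)"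

end

theory Submission
  imports Defs
begin

text \<open>
  Let \<open>\<kappa>\<^sub>v\<close> be the unique morphism from the initial vertex \<open>\<alpha>\<close> to the vertex \<open>v\<close>. For every
  morphism \<open>\<mu>\<close>, the composite \<open>\<mu> \<kappa>\<^bsub>s(\<mu>)\<^esub>\<close> is a morphism from \<open>\<alpha>\<close> to \<open>r(\<mu>)\<close>, so it equals
  \<open>\<kappa>\<^bsub>r(\<mu>)\<^esub>\<close>. Hence the box of \<open>\<mu>\<close> sits as the initial part of the box of \<open>\<kappa>\<^bsub>r(\<mu>)\<^esub>\<close>, and every
  point \<open>[\<mu>, x]\<close> of the realization can also be written \<open>[\<kappa>\<^bsub>r(\<mu>)\<^esub>, x]\<close>. The far corner
  \<open>d(\<kappa>\<^bsub>r(\<mu>)\<^esub>)\<close> of the larger box represents the vertex \<open>\<alpha>\<close>. The contraction moves each point in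
  a straight line to that corner:
  \<open>[\<mu>, x] \<mapsto> [\<kappa>\<^bsub>r(\<mu>)\<^esub>, (1 - t) x + t d(\<kappa>\<^bsub>r(\<mu>)\<^esub>)]\<close>.

  The point is that this does not depend on the representative. Write \<open>\<sigma> = \<mu>(\<lfloor>x\<rfloor>, \<lceil>x\<rceil>)\<close> and
  \<open>\<mu> = \<theta> \<sigma> \<rho>\<close> with \<open>d(\<theta>) = \<lfloor>x\<rfloor>\<close>. Then \<open>\<kappa>\<^bsub>r(\<mu>)\<^esub> = \<theta> \<kappa>\<^bsub>r(\<sigma>)\<^esub>\<close>, and the line just described is
  the translate by \<open>d(\<theta>)\<close> of the line from \<open>x - \<lfloor>x\<rfloor>\<close> to the far corner of the box of
  \<open>\<kappa>\<^bsub>r(\<sigma>)\<^esub>\<close>. Translation by \<open>d(\<theta>)\<close> is exactly the identification that the realization makes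
  when \<open>\<theta>\<close> is put in front (\<open>realization_rel_cmp_left\<close>). So the moving point depends only on \<open>\<sigma>\<close>
  and \<open>x - \<lfloor>x\<rfloor>\<close>, which is what equivalent representatives share (\<open>slide_respects_segment\<close>).

  Continuity is checked one box at a time, before passing to the quotient; the formula descends
  because the product of a quotient map with the compact Hausdorff space \<open>[0, 1]\<close> is again a
  quotient map (\<open>contractible_space_quotient\<close>).
\<close>

section \<open>Homotopies on sums and quotients\<close>

text \<open>
  Products distribute over sums: the sets \<open>Z \<times> ({i} \<times> X i)\<close> are open in the product and cover it,
  so continuity may be tested on each of them.
\<close>

lemma continuous_map_prod_sum_topology:
  assumes "\<And>i. i \<in> I \<Longrightarrow> continuous_map (prod_topology Z (X i)) Y (\<lambda>(t, x). f (t, i, x))"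
  shows "continuous_map (prod_topology Z (sum_topology X I)) Y f"
  unfolding continuous_map_def
proof (intro conjI allI impI)
  show "f \<in> topspace (prod_topology Z (sum_topology X I)) \<rightarrow> topspace Y"
  proof
    fix p assume "p \<in> topspace (prod_topology Z (sum_topology X I))"
    then obtain t i x where "p = (t, i, x)" "i \<in> I" "(t, x) \<in> topspace (prod_topology Z (X i))"
      by auto
    then show "f p \<in> topspace Y"
      using continuous_map_image_subset_topspace[OF assms, of i] by force
  qed
next
  fix U assume U: "openin Y U"
  let ?W = "{p \<in> topspace (prod_topology Z (sum_topology X I)). f p \<in> U}"
  have "\<exists>A B. openin Z A \<and> openin (sum_topology X I) B \<and> t \<in> A \<and> p \<in> B \<and> A \<times> B \<subseteq> ?W"
    if tp: "(t, p) \<in> ?W" for t p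
  proof -
    obtain i x where p: "p = (i, x)" and i: "i \<in> I"
      using tp by auto
    let ?V = "{q \<in> topspace (prod_topology Z (X i)). (\<lambda>(t, x). f (t, i, x)) q \<in> U}"
    have "openin (prod_topology Z (X i)) ?V"
      using assms[OF i] U unfolding continuous_map_def by blast
    moreover have "(t, x) \<in> ?V"
      using tp p by auto
    ultimately obtain A B where AB: "openin Z A" "openin (X i) B" "t \<in> A" "x \<in> B" "A \<times> B \<subseteq> ?V"
      unfolding openin_prod_topology_alt by meson
    have "openin (sum_topology X I) (Pair i ` B)"
      using open_map_component_injection[OF i, of X] AB(2) by (simp add: open_map_def)
    moreover have "A \<times> Pair i ` B \<subseteq> ?W"
      using AB(5) i by auto
    ultimately show ?thesis
      using AB p by blast
  qed
  then show "openin (prod_topology Z (sum_topology X I)) ?W"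
    by (subst openin_prod_topology_alt) (intro allI impI)
qed

text \<open>
  A homotopy \<open>H\<close> from the quotient map \<open>q\<close> to a constant descends to a contraction of the quotient
  if it is constant on the fibres of \<open>q\<close>: since \<open>[0, 1]\<close> is compact Hausdorff, \<open>id \<times> q\<close> is a
  quotient map, so the induced map on \<open>[0, 1] \<times> Y\<close> is continuous.
\<close>

lemma contractible_space_quotient:
  fixes H :: "real \<times> 'a \<Rightarrow> 'b"
  assumes q: "quotient_map X Y q"
    and H: "continuous_map (prod_topology (top_of_set {0..1}) X) Y H"
    and resp: "\<And>t x y. \<lbrakk>t \<in> {0..1}; x \<in> topspace X; y \<in> topspace X; q x = q y\<rbrakk> \<Longrightarrow> H (t, x) = H (t, y)"
    and H0: "\<And>x. x \<in> topspace X \<Longrightarrow> H (0, x) = q x"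
    and H1: "\<And>x. x \<in> topspace X \<Longrightarrow> H (1, x) = a"
  shows "contractible_space Y"
proof -
  let ?I = "top_of_set {0..1::real}"
  define g where "g y = (SOME x. x \<in> topspace X \<and> q x = y)" for y
  have g: "g y \<in> topspace X \<and> q (g y) = y" if "y \<in> topspace Y" for y
  proof -
    have "\<exists>x. x \<in> topspace X \<and> q x = y"
      using that unfolding quotient_imp_surjective_map[OF q, symmetric] by blast
    then show ?thesis unfolding g_def by (rule someI_ex)
  qed
  define h where "h = (\<lambda>(t, y). H (t, g y))"
  have qX: "q x \<in> topspace Y" if "x \<in> topspace X" for x
    using quotient_imp_surjective_map[OF q] that by auto
  have "quotient_map (prod_topology ?I X) (prod_topology ?I Y) (\<lambda>(t, x). (t, q x))"
    by (rule quotient_map_prod_right[OF _ _ q])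
      (auto intro!: compact_imp_locally_compact_space Hausdorff_space_subtopology
         simp: compact_space_subtopology)
  moreover have "continuous_map (prod_topology ?I X) Y (h \<circ> (\<lambda>(t, x). (t, q x)))"
  proof (rule continuous_map_eq[OF H])
    fix p assume "p \<in> topspace (prod_topology ?I X)"
    then obtain t x where "p = (t, x)" "t \<in> {0..1}" "x \<in> topspace X" by auto
    then show "H p = (h \<circ> (\<lambda>(t, x). (t, q x))) p"
      using resp[of t x "g (q x)"] g[OF qX] by (simp add: h_def)
  qed
  ultimately have "continuous_map (prod_topology ?I Y) Y h"
    by (rule continuous_compose_quotient_map)
  moreover have "h (0, y) = y" "h (1, y) = a" if "y \<in> topspace Y" for y
    using g[OF that] H0 H1 by (simp_all add: h_def)
  ultimately have "homotopic_with (\<lambda>x. True) Y Y id (\<lambda>y. a)"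
    by (subst homotopic_with) auto
  then show ?thesis
    unfolding contractible_space_def by blast
qed

section \<open>Points of the realization\<close>

lemma floor_le_ceiling_vec: "floor_vec x i \<le> ceiling_vec x i"
  by (simp add: floor_vec_def ceiling_vec_def nat_mono)

lemma ceiling_vec_le: "x i \<le> real n \<Longrightarrow> ceiling_vec x i \<le> n"
  by (simp add: ceiling_vec_def ceiling_le_iff nat_le_iff)

context k_graph
begin

text \<open>
  Degrees vanish from index \<open>k\<close> on, so there the bounds force the coordinate to be \<open>0\<close>; all
  coordinates can thus be treated alike.
\<close>

lemma mem_boxes_iff:
  "(\<mu>, x) \<in> topspace (boxes k \<Lambda>) \<longleftrightarrow>
     \<mu> \<in> Mor \<Lambda> \<and> (\<forall>i. 0 \<le> x i \<and> x i \<le> real (deg \<Lambda> \<mu> i))"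
proof -
  have "(\<forall>i\<ge>k. x i = 0) \<and> (\<forall>i<k. 0 \<le> x i \<and> x i \<le> real (deg \<Lambda> \<mu> i)) \<longleftrightarrow>
      (\<forall>i. 0 \<le> x i \<and> x i \<le> real (deg \<Lambda> \<mu> i))" if "\<mu> \<in> Mor \<Lambda>"
  proof -
    have "deg \<Lambda> \<mu> i = 0" if "k \<le> i" for i
      using deg_Nk[OF \<open>\<mu> \<in> Mor \<Lambda>\<close>] that by (simp add: Nk_def)
    then show ?thesis
      by (metis leI of_nat_0 order_antisym order_refl)
  qed
  then show ?thesis
    by (auto simp: boxes_def cube_def topspace_Euclidean_space)
qed

lemma is_segment_segment:
  assumes "(\<mu>, x) \<in> topspace (boxes k \<Lambda>)"
  shows "is_segment \<Lambda> \<mu> (floor_vec x) (ceiling_vec x)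
    (segment \<Lambda> \<mu> (floor_vec x) (ceiling_vec x))"
  unfolding segment_def
  by (rule theI'[OF ex1_segment])
    (use assms in \<open>auto simp: mem_boxes_iff floor_le_ceiling_vec ceiling_vec_le\<close>)

lemma segment_eqI:
  assumes "(\<mu>, x) \<in> topspace (boxes k \<Lambda>)" "is_segment \<Lambda> \<mu> (floor_vec x) (ceiling_vec x) \<sigma>"
  shows "segment \<Lambda> \<mu> (floor_vec x) (ceiling_vec x) = \<sigma>"
  unfolding segment_def
  by (rule the1_equality[OF ex1_segment])
    (use assms in \<open>auto simp: mem_boxes_iff floor_le_ceiling_vec ceiling_vec_le\<close>)

text \<open>
  A witness \<open>\<nu> = \<theta> \<sigma> \<rho>\<close> turns into the witness \<open>\<mu> \<nu> = (\<mu> \<theta>) \<sigma> \<rho>\<close>.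
\<close>

lemma is_segment_cmp_left:
  assumes "is_segment \<Lambda> \<nu> m n \<sigma>" "\<mu> \<in> Mor \<Lambda>" "\<nu> \<in> Mor \<Lambda>" "src \<Lambda> \<mu> = rng \<Lambda> \<nu>"
  shows "is_segment \<Lambda> (cmp \<Lambda> \<mu> \<nu>) (\<lambda>i. m i + deg \<Lambda> \<mu> i) (\<lambda>i. n i + deg \<Lambda> \<mu> i) \<sigma>"
proof -
  obtain \<theta> \<rho> where s: "\<sigma> \<in> Mor \<Lambda>" "deg \<Lambda> \<sigma> = (\<lambda>i. n i - m i)" "\<theta> \<in> Mor \<Lambda>" "\<rho> \<in> Mor \<Lambda>"
      "src \<Lambda> \<theta> = rng \<Lambda> \<sigma>" "src \<Lambda> \<sigma> = rng \<Lambda> \<rho>" "deg \<Lambda> \<theta> = m" "\<nu> = cmp \<Lambda> \<theta> (cmp \<Lambda> \<sigma> \<rho>)"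
    using assms(1) unfolding is_segment_def by blast
  have b: "cmp \<Lambda> \<sigma> \<rho> \<in> Mor \<Lambda>" "src \<Lambda> \<theta> = rng \<Lambda> (cmp \<Lambda> \<sigma> \<rho>)"
    using s by (simp_all add: cmp_Mor rng_cmp)
  have r: "src \<Lambda> \<mu> = rng \<Lambda> \<theta>"
    using assms(4) s(3,8) b by (simp add: rng_cmp)
  show ?thesis
    unfolding is_segment_def
  proof (intro conjI bexI)
    show "cmp \<Lambda> \<mu> \<nu> = cmp \<Lambda> (cmp \<Lambda> \<mu> \<theta>) (cmp \<Lambda> \<sigma> \<rho>)"
      using cmp_assoc[OF assms(2) s(3) b(1) r b(2)] s(8) by simp
    show "deg \<Lambda> (cmp \<Lambda> \<mu> \<theta>) = (\<lambda>i. m i + deg \<Lambda> \<mu> i)"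
      using deg_cmp[OF assms(2) s(3) r] s(7) by (simp add: add.commute)
  qed (use s r assms(2) in \<open>auto simp: src_cmp cmp_Mor\<close>)
qed

text \<open>
  A witness \<open>\<mu> = \<theta> \<sigma> \<rho>\<close> turns into the witness \<open>\<mu> \<nu> = \<theta> \<sigma> (\<rho> \<nu>)\<close>.
\<close>

lemma is_segment_cmp_right:
  assumes "is_segment \<Lambda> \<mu> m n \<sigma>" "\<mu> \<in> Mor \<Lambda>" "\<nu> \<in> Mor \<Lambda>" "src \<Lambda> \<mu> = rng \<Lambda> \<nu>"
  shows "is_segment \<Lambda> (cmp \<Lambda> \<mu> \<nu>) m n \<sigma>"
proof -
  obtain \<theta> \<rho> where s: "\<sigma> \<in> Mor \<Lambda>" "deg \<Lambda> \<sigma> = (\<lambda>i. n i - m i)" "\<theta> \<in> Mor \<Lambda>" "\<rho> \<in> Mor \<Lambda>"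
      "src \<Lambda> \<theta> = rng \<Lambda> \<sigma>" "src \<Lambda> \<sigma> = rng \<Lambda> \<rho>" "deg \<Lambda> \<theta> = m" "\<mu> = cmp \<Lambda> \<theta> (cmp \<Lambda> \<sigma> \<rho>)"
    using assms(1) unfolding is_segment_def by blast
  have b: "cmp \<Lambda> \<sigma> \<rho> \<in> Mor \<Lambda>" "src \<Lambda> \<theta> = rng \<Lambda> (cmp \<Lambda> \<sigma> \<rho>)"
    using s by (simp_all add: cmp_Mor rng_cmp)
  have r: "src \<Lambda> \<rho> = rng \<Lambda> \<nu>" "src \<Lambda> (cmp \<Lambda> \<sigma> \<rho>) = rng \<Lambda> \<nu>"
    using assms(4) s b by (simp_all add: src_cmp)
  show ?thesis
    unfolding is_segment_def
  proof (intro conjI bexI)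
    show "cmp \<Lambda> \<mu> \<nu> = cmp \<Lambda> \<theta> (cmp \<Lambda> \<sigma> (cmp \<Lambda> \<rho> \<nu>))"
      using cmp_assoc[OF s(3) b(1) assms(3) b(2) r(2)] cmp_assoc[OF s(1,4) assms(3) s(6) r(1)] s(8)
      by simp
  qed (use s r assms(3) in \<open>auto simp: rng_cmp cmp_Mor\<close>)
qed

text \<open>
  The realization glues the box of \<open>\<nu>\<close> to the far end of the box of \<open>\<mu> \<nu>\<close>: position \<open>0\<close> is at the
  range, so the part belonging to \<open>\<nu>\<close> begins at \<open>d(\<mu>)\<close>. Translation by an integer vector changes
  neither fractional parts nor the segment around a point.
\<close>

lemma realization_rel_cmp_left:
  assumes x: "(\<nu>, x) \<in> topspace (boxes k \<Lambda>)" and \<mu>: "\<mu> \<in> Mor \<Lambda>" "src \<Lambda> \<mu> = rng \<Lambda> \<nu>"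
  shows "((cmp \<Lambda> \<mu> \<nu>, \<lambda>i. x i + real (deg \<Lambda> \<mu> i)), (\<nu>, x)) \<in> realization_rel k \<Lambda>"
proof -
  let ?y = "\<lambda>i. x i + real (deg \<Lambda> \<mu> i)"
  have \<nu>: "\<nu> \<in> Mor \<Lambda>" and pos: "\<And>i. 0 \<le> x i"
    using x by (auto simp: mem_boxes_iff)
  have y: "(cmp \<Lambda> \<mu> \<nu>, ?y) \<in> topspace (boxes k \<Lambda>)"
    using x \<mu> by (auto simp: mem_boxes_iff cmp_Mor deg_cmp)
  have int: "?y i = x i + of_int (int (deg \<Lambda> \<mu> i))" for i
    by simp
  have fl: "floor_vec ?y = (\<lambda>i. floor_vec x i + deg \<Lambda> \<mu> i)"
    using pos unfolding floor_vec_def int floor_add_int[symmetric]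
    by (simp add: nat_add_distrib)
  have ce: "ceiling_vec ?y = (\<lambda>i. ceiling_vec x i + deg \<Lambda> \<mu> i)"
  proof
    fix i
    have "0 \<le> \<lceil>x i\<rceil>" using pos[of i] by (simp add: le_ceiling_iff order_less_le_trans[of "-1" 0])
    then show "ceiling_vec ?y i = ceiling_vec x i + deg \<Lambda> \<mu> i"
      unfolding ceiling_vec_def int ceiling_add_of_int by (simp add: nat_add_distrib)
  qed
  have "segment \<Lambda> (cmp \<Lambda> \<mu> \<nu>) (floor_vec ?y) (ceiling_vec ?y) =
      segment \<Lambda> \<nu> (floor_vec x) (ceiling_vec x)"
    by (rule segment_eqI[OF y])
      (simp only: fl ce is_segment_cmp_left[OF is_segment_segment[OF x] \<mu>(1) \<nu> \<mu>(2)])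
  then show ?thesis
    using x y by (simp add: realization_rel_def fl)
qed

text \<open>
  The box of \<open>\<mu>\<close> is glued to the near end of the box of \<open>\<mu> \<nu>\<close>, with the same coordinates.
\<close>

lemma realization_rel_cmp_right:
  assumes x: "(\<mu>, x) \<in> topspace (boxes k \<Lambda>)" and \<nu>: "\<nu> \<in> Mor \<Lambda>" "src \<Lambda> \<mu> = rng \<Lambda> \<nu>"
  shows "((cmp \<Lambda> \<mu> \<nu>, x), (\<mu>, x)) \<in> realization_rel k \<Lambda>"
proof -
  have \<mu>: "\<mu> \<in> Mor \<Lambda>"
    using x by (simp add: mem_boxes_iff)
  have y: "(cmp \<Lambda> \<mu> \<nu>, x) \<in> topspace (boxes k \<Lambda>)"
    using x \<nu> by (auto simp: mem_boxes_iff cmp_Mor deg_cmp add_increasing2)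
  have "segment \<Lambda> (cmp \<Lambda> \<mu> \<nu>) (floor_vec x) (ceiling_vec x) =
      segment \<Lambda> \<mu> (floor_vec x) (ceiling_vec x)"
    by (rule segment_eqI[OF y is_segment_cmp_right[OF is_segment_segment[OF x] \<mu> \<nu>]])
  then show ?thesis
    using x y by (simp add: realization_rel_def)
qed

end

section \<open>The straight-line contraction\<close>

locale k_graph_initial = k_graph +
  fixes \<alpha>
  assumes initial: "initial_vertex \<Lambda> \<alpha>"
begin

definition arrow where
  "arrow v = (THE \<kappa>. \<kappa> \<in> Mor \<Lambda> \<and> src \<Lambda> \<kappa> = \<alpha> \<and> rng \<Lambda> \<kappa> = v)"

lemma arrow:
  assumes "v \<in> Obj \<Lambda>"
  shows "arrow v \<in> Mor \<Lambda>" "src \<Lambda> (arrow v) = \<alpha>" "rng \<Lambda> (arrow v) = v"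
  using theI'[of "\<lambda>\<kappa>. \<kappa> \<in> Mor \<Lambda> \<and> src \<Lambda> \<kappa> = \<alpha> \<and> rng \<Lambda> \<kappa> = v"] initial assms
  unfolding initial_vertex_def arrow_def by auto

text \<open>
  Naturality of the arrows out of \<open>\<alpha>\<close>, by uniqueness. It allows the box of any morphism to be
  extended until it ends at \<open>\<alpha>\<close>.
\<close>

lemma cmp_arrow:
  assumes \<mu>: "\<mu> \<in> Mor \<Lambda>"
  shows "cmp \<Lambda> \<mu> (arrow (src \<Lambda> \<mu>)) = arrow (rng \<Lambda> \<mu>)"
proof -
  let ?\<kappa> = "arrow (src \<Lambda> \<mu>)"
  have k: "?\<kappa> \<in> Mor \<Lambda>" "src \<Lambda> ?\<kappa> = \<alpha>" "src \<Lambda> \<mu> = rng \<Lambda> ?\<kappa>"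
    using arrow src_Obj[OF \<mu>] by simp_all
  have "cmp \<Lambda> \<mu> ?\<kappa> \<in> Mor \<Lambda> \<and> src \<Lambda> (cmp \<Lambda> \<mu> ?\<kappa>) = \<alpha> \<and> rng \<Lambda> (cmp \<Lambda> \<mu> ?\<kappa>) = rng \<Lambda> \<mu>"
    using k \<mu> by (simp add: cmp_Mor src_cmp rng_cmp)
  moreover have "\<exists>!\<kappa>. \<kappa> \<in> Mor \<Lambda> \<and> src \<Lambda> \<kappa> = \<alpha> \<and> rng \<Lambda> \<kappa> = rng \<Lambda> \<mu>"
    using initial rng_Obj[OF \<mu>] unfolding initial_vertex_def by blast
  ultimately show ?thesis
    unfolding arrow_def[of "rng \<Lambda> \<mu>"] by (rule the1_equality[symmetric, rotated])
qed

lemma deg_arrow: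
  assumes "\<mu> \<in> Mor \<Lambda>"
  shows "deg \<Lambda> (arrow (rng \<Lambda> \<mu>)) i = deg \<Lambda> \<mu> i + deg \<Lambda> (arrow (src \<Lambda> \<mu>)) i"
proof -
  have "deg \<Lambda> (cmp \<Lambda> \<mu> (arrow (src \<Lambda> \<mu>))) =
      (\<lambda>i. deg \<Lambda> \<mu> i + deg \<Lambda> (arrow (src \<Lambda> \<mu>)) i)"
    by (rule deg_cmp) (use assms in \<open>simp_all add: arrow src_Obj\<close>)
  then show ?thesis
    by (simp add: cmp_arrow[OF assms])
qed

text \<open>
  The contraction at the level of boxes. At \<open>t = 0\<close> the coordinates are unchanged, but the point is
  already moved to the longer box; only its class stays the same.
\<close>

definition slide where
  "slide = (\<lambda>(t::real, \<mu>, x).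
     (arrow (rng \<Lambda> \<mu>), \<lambda>i. (1 - t) * x i + t * real (deg \<Lambda> (arrow (rng \<Lambda> \<mu>)) i)))"

lemma slide_mem_boxes:
  assumes t: "t \<in> {0..1}" and x: "(\<mu>, x) \<in> topspace (boxes k \<Lambda>)"
  shows "slide (t, \<mu>, x) \<in> topspace (boxes k \<Lambda>)"
proof -
  have \<mu>: "\<mu> \<in> Mor \<Lambda>" using x by (simp add: mem_boxes_iff)
  let ?d = "\<lambda>i. real (deg \<Lambda> (arrow (rng \<Lambda> \<mu>)) i)"
  have x': "0 \<le> x i" "x i \<le> ?d i" for i
    using x deg_arrow[OF \<mu>, of i] by (simp_all add: mem_boxes_iff add_increasing2)
  have "(1 - t) * x i + t * ?d i \<le> ?d i" for i
    using t x'[of i] by (intro convex_bound_le) auto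
  then show ?thesis
    using t x' \<mu> by (simp add: slide_def mem_boxes_iff arrow rng_Obj)
qed

lemma continuous_map_slide:
  "continuous_map (prod_topology (top_of_set {0..1}) (boxes k \<Lambda>)) (boxes k \<Lambda>) slide"
  unfolding boxes_def
proof (rule continuous_map_prod_sum_topology)
  fix \<mu> assume \<mu>: "\<mu> \<in> Mor \<Lambda>"
  let ?\<kappa> = "arrow (rng \<Lambda> \<mu>)" and ?S = "prod_topology (top_of_set {0..1::real}) (cube k (deg \<Lambda> \<mu>))"
  let ?g = "\<lambda>p i. (1 - fst p) * snd p i + fst p * real (deg \<Lambda> ?\<kappa> i)"
  have \<kappa>: "?\<kappa> \<in> Mor \<Lambda>" using \<mu> by (simp add: arrow rng_Obj)
  have fst: "continuous_map ?S euclideanreal fst"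
    using continuous_map_fst continuous_map_into_fulltopology by blast
  have cube: "continuous_map X (cube k n) f \<longleftrightarrow>
      continuous_map X (powertop_real UNIV) f \<and> f \<in> topspace X \<rightarrow> topspace (cube k n)"
    for X :: "(real \<times> (nat \<Rightarrow> real)) topology" and n f
    by (auto simp: cube_def Euclidean_space_def continuous_map_in_subtopology)
  have "continuous_map ?S (powertop_real UNIV) snd"
    using continuous_map_snd[of "top_of_set {0..1::real}" "cube k (deg \<Lambda> \<mu>)"]
    unfolding cube[of ?S] by (rule conjunct1)
  then have snd: "continuous_map ?S euclideanreal (\<lambda>p. snd p i)" for i
    by (simp add: continuous_map_componentwise_UNIV)
  have "continuous_map ?S (powertop_real UNIV) ?g"
    unfolding continuous_map_componentwise_UNIV
    by (intro allI continuous_intros fst snd)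
  moreover have "?g p \<in> topspace (cube k (deg \<Lambda> ?\<kappa>))" if p: "p \<in> topspace ?S" for p
  proof -
    have "slide (fst p, \<mu>, snd p) \<in> topspace (boxes k \<Lambda>)"
      using p \<mu> by (intro slide_mem_boxes) (auto simp: boxes_def)
    then show ?thesis
      using p \<kappa> by (simp add: slide_def boxes_def)
  qed
  ultimately have "continuous_map ?S (cube k (deg \<Lambda> ?\<kappa>)) ?g"
    unfolding cube by blast
  then have "continuous_map ?S (sum_topology (\<lambda>\<mu>. cube k (deg \<Lambda> \<mu>)) (Mor \<Lambda>)) (Pair ?\<kappa> \<circ> ?g)"
    using continuous_map_component_injection[OF \<kappa>, of "\<lambda>\<mu>. cube k (deg \<Lambda> \<mu>)"]
    by (rule continuous_map_compose)
  moreover have "(\<lambda>(t, x). slide (t, \<mu>, x)) = Pair ?\<kappa> \<circ> ?g"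
    by (rule ext) (simp add: slide_def split_beta)
  ultimately show "continuous_map ?S (sum_topology (\<lambda>\<mu>. cube k (deg \<Lambda> \<mu>)) (Mor \<Lambda>))
      (\<lambda>(t, x). slide (t, \<mu>, x))"
    by simp
qed

text \<open>
  Every point has a canonical representative, in the box of the segment \<open>\<sigma>\<close> around it, with its
  fractional parts as coordinates. Sliding the point and sliding this representative differ by the
  translation of \<open>realization_rel_cmp_left\<close>, because
  \<open>d(\<kappa>\<^bsub>r(\<mu>)\<^esub>) = \<lfloor>x\<rfloor> + d(\<kappa>\<^bsub>r(\<sigma>)\<^esub>)\<close>.
\<close>

lemma slide_respects_segment:
  assumes t: "t \<in> {0..1}" and x: "(\<mu>, x) \<in> topspace (boxes k \<Lambda>)"
  shows "(slide (t, \<mu>, x),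
      slide (t, segment \<Lambda> \<mu> (floor_vec x) (ceiling_vec x), \<lambda>i. x i - real (floor_vec x i)))
    \<in> realization_rel k \<Lambda>"
proof -
  define \<sigma> where "\<sigma> = segment \<Lambda> \<mu> (floor_vec x) (ceiling_vec x)"
  let ?f = "\<lambda>i. x i - real (floor_vec x i)"
  obtain \<theta> \<rho> where s: "\<sigma> \<in> Mor \<Lambda>" "deg \<Lambda> \<sigma> = (\<lambda>i. ceiling_vec x i - floor_vec x i)"
      "\<theta> \<in> Mor \<Lambda>" "\<rho> \<in> Mor \<Lambda>" "src \<Lambda> \<theta> = rng \<Lambda> \<sigma>" "src \<Lambda> \<sigma> = rng \<Lambda> \<rho>"
      "deg \<Lambda> \<theta> = floor_vec x" "\<mu> = cmp \<Lambda> \<theta> (cmp \<Lambda> \<sigma> \<rho>)"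
    using is_segment_segment[OF x] unfolding is_segment_def \<sigma>_def[symmetric] by blast
  have r: "rng \<Lambda> \<mu> = rng \<Lambda> \<theta>"
    unfolding s(8) using s(1-6) by (simp add: rng_cmp cmp_Mor)
  have e: "cmp \<Lambda> \<theta> (arrow (rng \<Lambda> \<sigma>)) = arrow (rng \<Lambda> \<mu>)"
    using cmp_arrow[OF s(3)] s(5) r by simp
  have d: "deg \<Lambda> (arrow (rng \<Lambda> \<mu>)) i = floor_vec x i + deg \<Lambda> (arrow (rng \<Lambda> \<sigma>)) i" for i
    using deg_arrow[OF s(3), of i] s(5,7) r by simp
  have pos: "0 \<le> x i" for i
    using x by (simp add: mem_boxes_iff)
  have "(\<sigma>, ?f) \<in> topspace (boxes k \<Lambda>)"
  proof -
    have "0 \<le> ?f i" "?f i \<le> real (ceiling_vec x i - floor_vec x i)" for i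
    proof -
      show "0 \<le> ?f i" using pos[of i] by (simp add: floor_vec_def)
      have "x i \<le> real (ceiling_vec x i)"
        by (simp add: ceiling_vec_def) linarith
      then show "?f i \<le> real (ceiling_vec x i - floor_vec x i)"
        using floor_le_ceiling_vec[of x i] by (simp add: of_nat_diff)
    qed
    then show ?thesis using s(1,2) by (simp add: mem_boxes_iff)
  qed
  from slide_mem_boxes[OF t this]
  have "((cmp \<Lambda> \<theta> (arrow (rng \<Lambda> \<sigma>)),
        \<lambda>i. ((1 - t) * ?f i + t * real (deg \<Lambda> (arrow (rng \<Lambda> \<sigma>)) i)) + real (deg \<Lambda> \<theta> i)),
      slide (t, \<sigma>, ?f)) \<in> realization_rel k \<Lambda>"
    unfolding slide_def prod.case
    by (rule realization_rel_cmp_left) (use s(1,3,5) in \<open>simp_all add: arrow rng_Obj\<close>)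
  moreover have "slide (t, \<mu>, x) = (cmp \<Lambda> \<theta> (arrow (rng \<Lambda> \<sigma>)),
        \<lambda>i. ((1 - t) * ?f i + t * real (deg \<Lambda> (arrow (rng \<Lambda> \<sigma>)) i)) + real (deg \<Lambda> \<theta> i))"
    by (simp add: slide_def e d s(7) fun_eq_iff algebra_simps)
  ultimately show ?thesis by (simp add: \<sigma>_def)
qed

text \<open>
  Equivalent points have the same canonical representative.
\<close>

lemma slide_respects_rel:
  assumes t: "t \<in> {0..1}" and xy: "((\<mu>, x), (\<nu>, y)) \<in> realization_rel k \<Lambda>"
  shows "(slide (t, \<mu>, x), slide (t, \<nu>, y)) \<in> realization_rel k \<Lambda>"
proof -
  have xy': "(\<mu>, x) \<in> topspace (boxes k \<Lambda>)" "(\<nu>, y) \<in> topspace (boxes k \<Lambda>)"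
    and eq: "segment \<Lambda> \<mu> (floor_vec x) (ceiling_vec x) = segment \<Lambda> \<nu> (floor_vec y) (ceiling_vec y)"
      "(\<lambda>i. x i - real (floor_vec x i)) = (\<lambda>i. y i - real (floor_vec y i))"
    using xy by (auto simp: realization_rel_def)
  have "sym (realization_rel k \<Lambda>)" "trans (realization_rel k \<Lambda>)"
    using equiv_realization_rel[of k \<Lambda>] by (auto elim: equivE)
  then show ?thesis
    using slide_respects_segment[OF t xy'(1)] slide_respects_segment[OF t xy'(2)]
    unfolding eq by (blast dest: symD transD)
qed

lemma slide_0:
  assumes x: "(\<mu>, x) \<in> topspace (boxes k \<Lambda>)"
  shows "(slide (0, \<mu>, x), (\<mu>, x)) \<in> realization_rel k \<Lambda>"
proof -
  have \<mu>: "\<mu> \<in> Mor \<Lambda>" using x by (simp add: mem_boxes_iff)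
  then show ?thesis
    using realization_rel_cmp_right[OF x, of "arrow (src \<Lambda> \<mu>)"]
    by (simp add: slide_def cmp_arrow arrow src_Obj)
qed

text \<open>
  The far corner of the box of \<open>\<kappa> = \<kappa> id\<^sub>\<alpha>\<close> is the single point of the box of \<open>id\<^sub>\<alpha>\<close>, translated by
  \<open>d(\<kappa>)\<close>.
\<close>

lemma slide_1:
  assumes x: "(\<mu>, x) \<in> topspace (boxes k \<Lambda>)"
  shows "(slide (1, \<mu>, x), (idn \<Lambda> \<alpha>, \<lambda>i. 0)) \<in> realization_rel k \<Lambda>"
proof -
  let ?\<kappa> = "arrow (rng \<Lambda> \<mu>)"
  have \<kappa>: "?\<kappa> \<in> Mor \<Lambda>" "src \<Lambda> ?\<kappa> = \<alpha>" using x by (simp_all add: mem_boxes_iff arrow rng_Obj)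
  have \<alpha>: "\<alpha> \<in> Obj \<Lambda>" using initial by (simp add: initial_vertex_def)
  have "(idn \<Lambda> \<alpha>, \<lambda>i. 0) \<in> topspace (boxes k \<Lambda>)"
    using \<alpha> by (simp add: mem_boxes_iff idn_Mor)
  from realization_rel_cmp_left[OF this \<kappa>(1)] show ?thesis
    using \<alpha> \<kappa> cmp_idn_right[OF \<kappa>(1)] by (simp add: slide_def rng_idn)
qed

lemma contractible_realization: "contractible_space (realization k \<Lambda>)"
proof -
  let ?R = "realization_rel k \<Lambda>"
  note equiv = equiv_realization_rel[of k \<Lambda>]
  have q: "quotient_map (boxes k \<Lambda>) (realization k \<Lambda>) (\<lambda>p. ?R `` {p})"
    unfolding realization_def by (rule quotient_map_quotient_space)
  show ?thesis
  proof (rule contractible_space_quotient[OF q])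
    show "continuous_map (prod_topology (top_of_set {0..1}) (boxes k \<Lambda>)) (realization k \<Lambda>)
        ((\<lambda>p. ?R `` {p}) \<circ> slide)"
      using continuous_map_slide quotient_imp_continuous_map[OF q] by (rule continuous_map_compose)
  next
    fix t :: real and p p'
    assume "t \<in> {0..1}" "p \<in> topspace (boxes k \<Lambda>)" "p' \<in> topspace (boxes k \<Lambda>)"
      and "?R `` {p} = ?R `` {p'}"
    moreover from this have "(p, p') \<in> ?R"
      using eq_equiv_class[OF _ equiv] by blast
    ultimately show "((\<lambda>p. ?R `` {p}) \<circ> slide) (t, p) = ((\<lambda>p. ?R `` {p}) \<circ> slide) (t, p')"
      using equiv_class_eq[OF equiv slide_respects_rel, of t "fst p" "snd p" "fst p'" "snd p'"]
      by simp
  next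
    fix p assume "p \<in> topspace (boxes k \<Lambda>)"
    then show "((\<lambda>p. ?R `` {p}) \<circ> slide) (0, p) = ?R `` {p}"
      using equiv_class_eq[OF equiv slide_0, of "fst p" "snd p"] by simp
  next
    fix p assume "p \<in> topspace (boxes k \<Lambda>)"
    then show "((\<lambda>p. ?R `` {p}) \<circ> slide) (1, p) = ?R `` {(idn \<Lambda> \<alpha>, \<lambda>i. 0)}"
      using equiv_class_eq[OF equiv slide_1, of "fst p" "snd p"] by simp
  qed
qed

end

theorem proposition5p6:
  fixes k :: nat and \<Lambda> :: "('v, 'm) graded_category"
  assumes "k_graph k \<Lambda>"
    and "\<exists>\<alpha>. initial_vertex \<Lambda> \<alpha>"
  shows "contractible_space (realization k \<Lambda>)"
proof -
  obtain \<alpha> where "initial_vertex \<Lambda> \<alpha>"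
    using assms(2) ..
  with assms(1) interpret k_graph_initial k \<Lambda> \<alpha>
    by (intro k_graph_initial.intro k_graph_initial_axioms.intro)
  show ?thesis
    by (rule contractible_realization)
qed

end
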